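(* Let $F=\{n_F\}_{n\geq 0}$ be a cobweb-admissible sequence of positive integers. Then $F$ is the pointwise product of primary cobweb-admissible sequences: for each prime $p$ there is a primary cobweb-admissible sequence $P(p)=\{n_{P(p)}\}_{n\geq 0}$ whose values lie in $\{1,p,p^2,p^3,\dots\}$, such that for every $n\geq 0$ we have $n_F=\prod_{p \text{ prime}} n_{P(p)}$, where for each fixed $n$ only finitely many factors differ from $1$.
   Context: A sequence $F=\{n_F\}_{n\geq 0}$ of positive integers is called cobweb-admissible if for all integers $0\leq k\leq n$ the $F$-nomial coefficient $$\binom{n}{k}_F=\frac{n_F\cdot (n-1)_F\cdots (n-k+1)_F}{1_F\cdot 2_F\cdots k_F}$$ is a positive integer (the empty product, for $k=0$, equals $1$). For a prime $p$, a primary cobweb-admissible sequence is a cobweb-admissible sequence $\{n_P\}_{n\geq 0}$ all of whose values lie in $\{1,p,p^2,p^3,\dots\}$. *)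

theory Defs
  imports Complex_Main "HOL-Computational_Algebra.Primes"
begin

(* Rational-valued, so that integrality is a genuine condition; used for k \<le> n only. *)
definition fnomial :: "(nat \<Rightarrow> nat) \<Rightarrow> nat \<Rightarrow> nat \<Rightarrow> rat" where
  "fnomial F n k = (\<Prod>i = n - k + 1..n. of_nat (F i)) / (\<Prod>i = 1..k. of_nat (F i))"

definition cobweb_admissible :: "(nat \<Rightarrow> nat) \<Rightarrow> bool" where
  "cobweb_admissible F \<longleftrightarrow>
     (\<forall>n. F n > 0) \<and> (\<forall>n k. k \<le> n \<longrightarrow> fnomial F n k \<in> \<int> \<and> fnomial F n k > 0)"

definition primary_cobweb_admissible :: "nat \<Rightarrow> (nat \<Rightarrow> nat) \<Rightarrow> bool" where
  "primary_cobweb_admissible p P \<longleftrightarrow>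
     prime p \<and> cobweb_admissible P \<and> (\<forall>n. P n \<in> {p ^ k | k. True})"

end

theory Submission
  imports Defs
begin

text \<open>For each prime p, let the value at n be the p-part of \<open>F n\<close>, that is p to
  the power \<open>multiplicity p (F n)\<close>. Unique factorization then recovers
  \<open>F n\<close> as the product over p. Admissibility of the p-parts is inherited: by
  \<open>cobweb_admissible_iff_dvd\<close> it is a family of divisibilities between products of
  values, and the p-adic valuation turns products into sums and divisibility into \<le>, which gives
  \<open>primary_cobweb_admissible_power_multiplicity\<close>.\<close>

lemma of_nat_divide_in_Ints_iff_dvd:
  fixes a b :: nat
  assumes "b > 0"
  shows "(of_nat a / of_nat b :: 'a :: field_char_0) \<in> \<int> \<longleftrightarrow> b dvd a"
proof
  assume "(of_nat a / of_nat b :: 'a) \<in> \<int>"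
  then obtain z where "(of_nat a / of_nat b :: 'a) = of_int z"
    by (elim Ints_cases)
  then have "(of_int (int a) :: 'a) = of_int (z * int b)"
    using assms by (simp add: field_simps)
  then have "int a = z * int b"
    by (simp only: of_int_eq_iff)
  then have "int b dvd int a"
    by simp
  then show "b dvd a"
    by simp
next
  assume "b dvd a"
  then show "(of_nat a / of_nat b :: 'a) \<in> \<int>"
    using assms by (auto elim!: dvdE)
qed

text \<open>Positive values make every F-nomial coefficient a positive rational, so only integrality
  carries content. This moves the condition from \<open>rat\<close> to \<open>nat\<close>, where
  valuations apply.\<close>

lemma cobweb_admissible_iff_dvd:
  "cobweb_admissible F \<longleftrightarrow>
     (\<forall>n. F n > 0) \<and> (\<forall>n k. k \<le> n \<longrightarrow> (\<Prod>i = 1..k. F i) dvd (\<Prod>i = n - k + 1..n. F i))"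
proof (cases "\<forall>n. F n > 0")
  case True
  have "fnomial F n k > 0" for n k
    using True by (auto simp: fnomial_def intro!: divide_pos_pos prod_pos)
  moreover have "fnomial F n k \<in> \<int> \<longleftrightarrow> (\<Prod>i = 1..k. F i) dvd (\<Prod>i = n - k + 1..n. F i)" for n k
  proof -
    have "fnomial F n k = of_nat (\<Prod>i = n - k + 1..n. F i) / of_nat (\<Prod>i = 1..k. F i)"
      by (simp add: fnomial_def of_nat_prod)
    moreover have "(\<Prod>i = 1..k. F i) > 0"
      using True by (intro prod_pos) auto
    ultimately show ?thesis
      by (metis of_nat_divide_in_Ints_iff_dvd)
  qed
  ultimately show ?thesis
    using True by (simp add: cobweb_admissible_def)
next
  case False
  then show ?thesis
    unfolding cobweb_admissible_def by blast
qed

lemma primary_cobweb_admissible_power_multiplicity: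
  fixes F :: "nat \<Rightarrow> nat"
  assumes F: "cobweb_admissible F" and p: "prime p"
  shows "primary_cobweb_admissible p (\<lambda>n. p ^ multiplicity p (F n))"
proof -
  have pos: "F n > 0" for n
    using F by (simp add: cobweb_admissible_def)
  \<comment> \<open>Taking p-parts commutes with finite products, since the valuation is additive on
    nonzero factors.\<close>
  have prod_eq: "(\<Prod>i\<in>A. p ^ multiplicity p (F i)) = p ^ multiplicity p (\<Prod>i\<in>A. F i)"
    if "finite A" for A
    using that p pos
    by (subst prime_elem_multiplicity_prod_distrib)
       (auto simp: power_sum prime_imp_prime_elem less_imp_neq)
  \<comment> \<open>Between powers of p, an inequality of exponents is enough for
    divisibility.\<close>
  have "multiplicity p (\<Prod>i = 1..k. F i) \<le> multiplicity p (\<Prod>i = n - k + 1..n. F i)"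
    if "k \<le> n" for n k
    using that F pos
    by (intro dvd_imp_multiplicity_le) (auto simp: cobweb_admissible_iff_dvd)
  then have "cobweb_admissible (\<lambda>n. p ^ multiplicity p (F n))"
    using prime_gt_0_nat[OF p] by (simp add: cobweb_admissible_iff_dvd prod_eq le_imp_power_dvd)
  then show ?thesis
    using p by (auto simp: primary_cobweb_admissible_def)
qed

theorem theorem1:
  fixes F :: "nat \<Rightarrow> nat"
  assumes "cobweb_admissible F"
  shows "\<exists>P :: nat \<Rightarrow> nat \<Rightarrow> nat.
           (\<forall>p. prime p \<longrightarrow> primary_cobweb_admissible p (P p)) \<and>
           (\<forall>n. finite {p. prime p \<and> P p n \<noteq> 1} \<and>
                F n = (\<Prod>p | prime p \<and> P p n \<noteq> 1. P p n))"
proof -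
  define P where "P p n = p ^ multiplicity p (F n)" for p n
  have "finite {p. prime p \<and> P p n \<noteq> 1} \<and> F n = (\<Prod>p | prime p \<and> P p n \<noteq> 1. P p n)" for n
  proof -
    have pos: "F n > 0"
      using assms by (simp add: cobweb_admissible_def)
    \<comment> \<open>A power of a prime is 1 only for exponent 0, so the nontrivial factors belong
      to the prime divisors of \<open>F n\<close>; this also gives finiteness.\<close>
    have "{p. prime p \<and> P p n \<noteq> 1} = prime_factors (F n)"
      using pos by (auto simp: P_def prime_factors_multiplicity)
    moreover have "F n = (\<Prod>p\<in>prime_factors (F n). P p n)"
      using prime_factorization_nat[OF pos] by (simp add: P_def)
    ultimately show ?thesis
      by simp
  qed
  moreover have "primary_cobweb_admissible p (P p)" if "prime p" for p
    using primary_cobweb_admissible_power_multiplicity[OF assms that]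
    by (simp add: P_def[abs_def])
  ultimately show ?thesis
    by blast
qed

end
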